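(* Suppose the predictive random set $\mathcal{S}$ is valid (for predicting the unobserved auxiliary variable), and $\Theta_x(\mathcal{S}) \neq \varnothing$ with $\mathsf{P}_{\mathcal{S}}$-probability $1$ for all $x \in \mathbb{X}$. Then the inferential model is valid; that is, for every assertion $A \subseteq \Theta$ and every $\alpha \in (0,1)$, $$\sup_{\theta \notin A} \mathsf{P}_{X|\theta}\bigl\{ \mathsf{bel}_X(A;\mathcal{S}) \geq 1-\alpha \bigr\} \leq \alpha .$$
   Context: Setting. $\mathbb{X}$ is the sample space, $\Theta$ the parameter space, and $(\mathbb{U}, \mathsf{P}_U)$ a probability space (the auxiliary variable space). An association is a map $a$ taking $(u,\theta)\in\mathbb{U}\times\Theta$ to $a(u,\theta) \in \mathbb{X}$ such that, for each $\theta\in\Theta$, the sampling distribution $\mathsf{P}_{X|\theta}$ of the observable $X$ is the distribution of $a(U,\theta)$ when $U \sim \mathsf{P}_U$. For $x \in \mathbb{X}$, $u \in \mathbb{U}$, put $\Theta_x(u) = \{\theta \in \Theta : x = a(u,\theta)\}$. A predictive random set $\mathcal{S}$ is a random subset of $\mathbb{U}$ with distribution $\mathsf{P}_{\mathcal{S}}$. Put $Q_{\mathcal{S}}(u) = \mathsf{P}_{\mathcal{S}}\{\mathcal{S} \not\ni u\}$, $u \in \mathbb{U}$. $\mathcal{S}$ is valid if $\mathsf{P}_U\{Q_{\mathcal{S}}(U) \geq 1-\alpha\} \leq \alpha$ for each $\alpha \in (0,1)$, where $U\sim \mathsf{P}_U$. Put $\Theta_x(\mathcal{S}) = \bigcup_{u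 \in \mathcal{S}} \Theta_x(u)$. An assertion is a subset $A\subseteq\Theta$. The belief function is $\mathsf{bel}_x(A;\mathcal{S}) = \mathsf{P}_{\mathcal{S}}\{\Theta_x(\mathcal{S}) \subseteq A \mid \Theta_x(\mathcal{S}) \neq \varnothing\}$. The inferential model (IM) is the resulting procedure determined by the association and $\mathcal{S}$, with output $\mathsf{bel}_x$. Conventions: the functions $u \mapsto Q_{\mathcal{S}}(u)$ and $x \mapsto \mathsf{bel}_x(A;\mathcal{S})$ are assumed measurable, and the events for $\mathcal{S}$ whose probabilities appear are assumed measurable; a supremum of probabilities over an empty index set is $0$. *)

theory Defs
  imports "HOL-Probability.Probability"
begin

text \<open>
  The auxiliary variable space is a probability space \<open>PU\<close>, the sample space is the measurable
  space \<open>MX\<close>, and the parameter space is a plain set \<open>\<Theta>\<close> without a sigma-algebra.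
  A predictive random set is given by its distribution \<open>PS\<close>, a probability measure whose points
  are subsets of \<open>space PU\<close>.
\<close>

definition association ::
  "'u measure \<Rightarrow> 'x measure \<Rightarrow> 't set \<Rightarrow> ('u \<Rightarrow> 't \<Rightarrow> 'x) \<Rightarrow> ('t \<Rightarrow> 'x measure) \<Rightarrow> bool" where
  "association PU MX \<Theta> a PX \<longleftrightarrow>
     (\<forall>\<theta>\<in>\<Theta>. (\<lambda>u. a u \<theta>) \<in> measurable PU MX \<and> PX \<theta> = distr PU MX (\<lambda>u. a u \<theta>))"

definition Theta_pt :: "'t set \<Rightarrow> ('u \<Rightarrow> 't \<Rightarrow> 'x) \<Rightarrow> 'x \<Rightarrow> 'u \<Rightarrow> 't set" where
  "Theta_pt \<Theta> a x u = {\<theta> \<in> \<Theta>. x = a u \<theta>}"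

definition Theta_set :: "'t set \<Rightarrow> ('u \<Rightarrow> 't \<Rightarrow> 'x) \<Rightarrow> 'x \<Rightarrow> 'u set \<Rightarrow> 't set" where
  "Theta_set \<Theta> a x S = (\<Union>u\<in>S. Theta_pt \<Theta> a x u)"

text \<open>
  The second condition is the standing convention that the non-coverage events
  are measurable; without it \<open>measure\<close> would silently return 0.
\<close>

definition predictive_random_set :: "'u measure \<Rightarrow> 'u set measure \<Rightarrow> bool" where
  "predictive_random_set PU PS \<longleftrightarrow>
     prob_space PS \<and> space PS \<subseteq> Pow (space PU) \<and>
     (\<forall>u\<in>space PU. {S \<in> space PS. u \<notin> S} \<in> sets PS)"

definition Q :: "'u set measure \<Rightarrow> 'u \<Rightarrow> real" where
  "Q PS u = \<P>(S in PS. u \<notin> S)"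

definition prs_valid :: "'u measure \<Rightarrow> 'u set measure \<Rightarrow> bool" where
  "prs_valid PU PS \<longleftrightarrow>
     (\<forall>\<alpha>::real. 0 < \<alpha> \<and> \<alpha> < 1 \<longrightarrow> \<P>(u in PU. Q PS u \<ge> 1 - \<alpha>) \<le> \<alpha>)"

definition bel :: "'t set \<Rightarrow> ('u \<Rightarrow> 't \<Rightarrow> 'x) \<Rightarrow> 'u set measure \<Rightarrow> 'x \<Rightarrow> 't set \<Rightarrow> real" where
  "bel \<Theta> a PS x A =
     \<P>(S in PS. Theta_set \<Theta> a x S \<subseteq> A \<bar> Theta_set \<Theta> a x S \<noteq> {})"

end

theory Submission
  imports Defs
begin

text \<open>
  If \<open>x = a u \<theta>\<close> with \<open>\<theta> \<notin> A\<close>, then every \<open>S\<close> containing \<open>u\<close> has \<open>\<theta> \<in> Theta_set \<Theta> a x S\<close>, so belief in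
  \<open>A\<close> forces \<open>S\<close> to miss \<open>u\<close>. Hence the belief function at \<open>a u \<theta>\<close> is dominated by \<open>Q PS u\<close>, and
  validity of the random set carries over through the association.
\<close>

lemma bel_le_Q:
  assumes prs: "predictive_random_set PU PS"
    and u: "u \<in> space PU" and \<theta>: "\<theta> \<in> \<Theta> - A"
    and ne: "\<P>(S in PS. Theta_set \<Theta> a (a u \<theta>) S \<noteq> {}) = 1"
  shows "bel \<Theta> a PS (a u \<theta>) A \<le> Q PS u"
proof -
  interpret PS: prob_space PS
    using prs by (simp add: predictive_random_set_def)
  have "u \<notin> S" if "Theta_set \<Theta> a (a u \<theta>) S \<subseteq> A" for S
    using that \<theta> by (auto simp: Theta_set_def Theta_pt_def)
  moreover have "{S \<in> space PS. u \<notin> S} \<in> sets PS"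
    using prs u by (simp add: predictive_random_set_def)
  \<comment> \<open>Monotonicity of \<open>measure\<close> asks for measurability of the larger
    event, here non-coverage of \<open>u\<close>.\<close>
  ultimately have "\<P>(S in PS. Theta_set \<Theta> a (a u \<theta>) S \<subseteq> A \<and> Theta_set \<Theta> a (a u \<theta>) S \<noteq> {}) \<le> Q PS u"
    unfolding Q_def by (intro PS.finite_measure_mono) auto
  \<comment> \<open>By \<open>ne\<close> the conditioning event has probability 1, so the quotient
    defining \<open>bel\<close> is just the joint probability bounded above.\<close>
  then show ?thesis
    by (simp add: bel_def cond_prob_def ne)
qed

theorem theorem2:
  fixes PU :: "'u measure" and MX :: "'x measure" and \<Theta> :: "'t set"
    and a :: "'u \<Rightarrow> 't \<Rightarrow> 'x" and PX :: "'t \<Rightarrow> 'x measure"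
    and PS :: "'u set measure" and A :: "'t set" and \<alpha> :: real
  assumes PU: "prob_space PU"
    and assoc: "association PU MX \<Theta> a PX"
    and prs: "predictive_random_set PU PS"
    and Q_meas: "Q PS \<in> borel_measurable PU"
    and nonempty_event:
      "\<And>x. x \<in> space MX \<Longrightarrow> {S \<in> space PS. Theta_set \<Theta> a x S \<noteq> {}} \<in> sets PS"
    and valid: "prs_valid PU PS"
    and nonempty: "\<And>x. x \<in> space MX \<Longrightarrow> \<P>(S in PS. Theta_set \<Theta> a x S \<noteq> {}) = 1"
    and A: "A \<subseteq> \<Theta>"
    and subset_event:
      "\<And>x. x \<in> space MX \<Longrightarrow> {S \<in> space PS. Theta_set \<Theta> a x S \<subseteq> A} \<in> sets PS"
    and bel_meas: "(\<lambda>x. bel \<Theta> a PS x A) \<in> borel_measurable MX"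
    and \<alpha>: "0 < \<alpha>" "\<alpha> < 1"
  shows "(SUP \<theta>\<in>\<Theta> - A. emeasure (PX \<theta>) {x \<in> space (PX \<theta>). bel \<Theta> a PS x A \<ge> 1 - \<alpha>})
           \<le> ennreal \<alpha>"
\<comment> \<open>The supremum lives in \<open>ennreal\<close>, where it is 0 over an empty index
  set; so A = \<Theta> needs no separate case.\<close>
proof (rule SUP_least)
  fix \<theta> assume \<theta>: "\<theta> \<in> \<Theta> - A"
  interpret PU: prob_space PU by (fact PU)
  let ?B = "{x \<in> space MX. bel \<Theta> a PS x A \<ge> 1 - \<alpha>}"
  from assoc \<theta> have a_meas: "(\<lambda>u. a u \<theta>) \<in> measurable PU MX"
    and PX: "PX \<theta> = distr PU MX (\<lambda>u. a u \<theta>)"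
    by (auto simp: association_def)
  have B: "?B \<in> sets MX"
    using bel_meas by measurable
  \<comment> \<open>Pulling the event back to the auxiliary space makes belief at
    \<open>a u \<theta>\<close> comparable with \<open>Q PS u\<close> point by point.\<close>
  have "emeasure (PX \<theta>) {x \<in> space (PX \<theta>). bel \<Theta> a PS x A \<ge> 1 - \<alpha>}
      = emeasure PU ((\<lambda>u. a u \<theta>) -` ?B \<inter> space PU)"
    using a_meas B by (simp add: PX emeasure_distr)
  also have "\<dots> \<le> emeasure PU {u \<in> space PU. Q PS u \<ge> 1 - \<alpha>}"
  proof (rule emeasure_mono)
    show "{u \<in> space PU. Q PS u \<ge> 1 - \<alpha>} \<in> sets PU"
      using Q_meas by measurable
    \<comment> \<open>Membership in \<open>?B\<close> places \<open>a u \<theta>\<close> in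
      \<open>space MX\<close>, as \<open>nonempty\<close> requires; then 1 - \<alpha> \<le> bel
      \<le> Q.\<close>
    show "(\<lambda>u. a u \<theta>) -` ?B \<inter> space PU \<subseteq> {u \<in> space PU. Q PS u \<ge> 1 - \<alpha>}"
      using bel_le_Q[OF prs _ \<theta> nonempty] by force
  qed
  also have "\<dots> \<le> ennreal \<alpha>"
    using valid \<alpha> by (simp add: PU.emeasure_eq_measure prs_valid_def ennreal_leI)
  finally show "emeasure (PX \<theta>) {x \<in> space (PX \<theta>). bel \<Theta> a PS x A \<ge> 1 - \<alpha>} \<le> ennreal \<alpha>" .
qed

end
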